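(* Let $r,p,l,k$ be integers with $1\le l\le r$ and $1\le k\le p$. Then in the ring $\Lambda$ of symmetric functions $$s_{[r|p]^l_k}\;s_{[r|p]}\;=\;s_{[r-1|p-1]^{l-1}_{k-1}}\;s_{[r+1|p+1]}\;+\;s_{[r|p]_k}\;s_{[r|p]^l}.$$
   Context: $\Lambda$ is the ring of symmetric functions in countably many variables and $s_\lambda\in\Lambda$ is the Schur symmetric function of the partition $\lambda$. For integers $r,p\ge 0$, $0\le l\le r$, $0\le k\le p$, the partition $[r|p]^l_k$ is $$[r|p]^l_k:=\bigl((p+1)^l,\,p^{\,r-l},\,k\bigr),$$ i.e. the $r\times p$ rectangle ($r$ rows of length $p$) with a column of $l$ boxes attached on the right at the top and a row of $k$ boxes attached below at the left. A zero index $l$ or $k$ is omitted: $[r|p]=(p^r)$, $[r|p]_k=(p^r,k)$, $[r|p]^l=((p+1)^l,p^{r-l})$. *)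

theory Defs
  imports "HOL-Library.Multiset" "HOL-Combinatorics.Transposition"
begin

section \<open>The ring of symmetric functions\<close>

text \<open>
  The monomial \<open>x\<^bsub>i1\<^esub> \<cdots> x\<^bsub>id\<^esub>\<close> in the variables \<open>x\<^sub>0, x\<^sub>1, x\<^sub>2, \<dots>\<close> is encoded as the multiset
  \<open>{#i1, \<dots>, id#}\<close> of its indices, so that multiplying monomials is adding multisets and
  \<open>size\<close> is the total degree. A formal power series with integer coefficients is then a
  function \<open>nat multiset \<Rightarrow> int\<close>; it is a symmetric function if it is invariant under all
  permutations of the variables and has bounded degree.
\<close>

typedef sym_fun =
  "{f :: nat multiset \<Rightarrow> int.
      (\<forall>\<pi> M. bij \<pi> \<longrightarrow> f (image_mset \<pi> M) = f M) \<and>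
      (\<exists>d. \<forall>M. size M > d \<longrightarrow> f M = 0)}"
  morphisms coeff Sym_fun
  by (rule exI[of _ "\<lambda>_. 0"]) simp

setup_lifting type_definition_sym_fun

lemma finite_add_decomp: "finite {(A, B). A + B = (M :: 'a multiset)}"
proof -
  have "{A. A \<subseteq># M} \<subseteq> (\<Union>n\<le>size M. multisets_of_size (set_mset M) n)"
    by (auto simp: multisets_of_size_def dest: size_mset_mono mset_subset_eqD)
  moreover have "finite (\<Union>n\<le>size M. multisets_of_size (set_mset M) n)"
    by auto
  ultimately have "finite {A. A \<subseteq># M}"
    by (rule finite_subset)
  then have "finite ((\<lambda>A. (A, M - A)) ` {A. A \<subseteq># M})"
    by simp
  moreover have "{(A, B). A + B = M} \<subseteq> (\<lambda>A. (A, M - A)) ` {A. A \<subseteq># M}"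
    by auto
  ultimately show ?thesis
    by (rule rev_finite_subset)
qed

lemma sum_add_decomp_assoc:
  fixes F :: "'a multiset \<Rightarrow> 'a multiset \<Rightarrow> 'a multiset \<Rightarrow> 'b :: comm_monoid_add"
  shows "(\<Sum>(D, C) | D + C = M. \<Sum>(A, B) | A + B = D. F A B C) =
    (\<Sum>(A, D) | A + D = M. \<Sum>(B, C) | B + C = D. F A B C)"
proof -
  have "(\<Sum>(D, C) | D + C = M. \<Sum>(A, B) | A + B = D. F A B C) =
      (\<Sum>p\<in>{(D, C). D + C = M}. \<Sum>q\<in>{(A, B). A + B = fst p}. F (fst q) (snd q) (snd p))"
    by (simp add: case_prod_unfold)
  also have "\<dots> = (\<Sum>(p, q)\<in>Sigma {(D, C). D + C = M} (\<lambda>p. {(A, B). A + B = fst p}).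
      F (fst q) (snd q) (snd p))"
    by (rule sum.Sigma) (use finite_add_decomp in auto)
  also have "\<dots> = (\<Sum>(p, q)\<in>Sigma {(A, D). A + D = M} (\<lambda>p. {(B, C). B + C = snd p}).
      F (fst p) (fst q) (snd q))"
    by (rule sum.reindex_bij_witness
          [where i = "\<lambda>(p, q). ((fst p + fst q, snd q), (fst p, fst q))"
             and j = "\<lambda>(p, q). ((fst q, snd q + snd p), (snd q, snd p))"])
       (auto simp: add.assoc)
  also have "\<dots> = (\<Sum>p\<in>{(A, D). A + D = M}. \<Sum>q\<in>{(B, C). B + C = snd p}. F (fst p) (fst q) (snd q))"
    by (rule sum.Sigma[symmetric]) (use finite_add_decomp in auto)
  also have "\<dots> = (\<Sum>(A, D) | A + D = M. \<Sum>(B, C) | B + C = D. F A B C)"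
    by (simp add: case_prod_unfold)
  finally show ?thesis .
qed

lemma sum_add_decomp_image:
  fixes \<pi> :: "'a \<Rightarrow> 'a"
  assumes "bij \<pi>"
  shows "(\<Sum>(A, B) | A + B = image_mset \<pi> M. F A B) =
    (\<Sum>(A, B) | A + B = M. F (image_mset \<pi> A) (image_mset \<pi> B))"
proof -
  have "inv \<pi> \<circ> \<pi> = id" "\<pi> \<circ> inv \<pi> = id"
    using assms by (auto simp: bij_def surj_iff inj_iff)
  then have "image_mset (inv \<pi>) (image_mset \<pi> A) = A" "image_mset \<pi> (image_mset (inv \<pi>) A) = A" for A
    by (simp_all add: multiset.map_comp)
  then show ?thesis
    by (intro sum.reindex_bij_witness
          [where j = "\<lambda>(A, B). (image_mset (inv \<pi>) A, image_mset (inv \<pi>) B)"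
             and i = "\<lambda>(A, B). (image_mset \<pi> A, image_mset \<pi> B)"])
       (auto simp flip: image_mset_union)
qed

instantiation sym_fun :: comm_ring_1
begin

lift_definition zero_sym_fun :: sym_fun is "\<lambda>_. 0" by simp

lift_definition one_sym_fun :: sym_fun is "\<lambda>M. if M = {#} then 1 else 0"
  by (auto intro: exI[of _ 0])

lift_definition plus_sym_fun :: "sym_fun \<Rightarrow> sym_fun \<Rightarrow> sym_fun" is "\<lambda>f g M. f M + g M"
proof -
  fix f g :: "nat multiset \<Rightarrow> int"
  assume "(\<forall>\<pi> M. bij \<pi> \<longrightarrow> f (image_mset \<pi> M) = f M) \<and> (\<exists>d. \<forall>M. size M > d \<longrightarrow> f M = 0)"
    and "(\<forall>\<pi> M. bij \<pi> \<longrightarrow> g (image_mset \<pi> M) = g M) \<and> (\<exists>d. \<forall>M. size M > d \<longrightarrow> g M = 0)"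
  moreover from this obtain d e where
    "\<forall>M. size M > d \<longrightarrow> f M = 0" "\<forall>M. size M > e \<longrightarrow> g M = 0"
    by blast
  then have "\<forall>M. size M > max d e \<longrightarrow> f M + g M = 0"
    by simp
  ultimately show "(\<forall>\<pi> M. bij \<pi> \<longrightarrow> f (image_mset \<pi> M) + g (image_mset \<pi> M) = f M + g M) \<and>
      (\<exists>d. \<forall>M. size M > d \<longrightarrow> f M + g M = 0)"
    by (intro conjI) (simp, blast)
qed

lift_definition uminus_sym_fun :: "sym_fun \<Rightarrow> sym_fun" is "\<lambda>f M. - f M" by simp

definition minus_sym_fun :: "sym_fun \<Rightarrow> sym_fun \<Rightarrow> sym_fun" where
  "minus_sym_fun f g = f + (- g)"

lift_definition times_sym_fun :: "sym_fun \<Rightarrow> sym_fun \<Rightarrow> sym_fun" is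
  "\<lambda>f g M. \<Sum>(A, B) | A + B = M. f A * g B"
proof -
  fix f g :: "nat multiset \<Rightarrow> int"
  assume *: "(\<forall>\<pi> M. bij \<pi> \<longrightarrow> f (image_mset \<pi> M) = f M) \<and> (\<exists>d. \<forall>M. size M > d \<longrightarrow> f M = 0)"
    "(\<forall>\<pi> M. bij \<pi> \<longrightarrow> g (image_mset \<pi> M) = g M) \<and> (\<exists>d. \<forall>M. size M > d \<longrightarrow> g M = 0)"
  from * obtain d e where d: "\<forall>M. size M > d \<longrightarrow> f M = 0" and e: "\<forall>M. size M > e \<longrightarrow> g M = 0"
    by blast
  have "f A * g B = 0" if "size (A + B) > d + e" for A B
    using d[rule_format, of A] e[rule_format, of B] that by (cases "size A > d") auto
  then have "\<forall>M. size M > d + e \<longrightarrow> (\<Sum>(A, B) | A + B = M. f A * g B) = 0"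
    by (auto intro!: sum.neutral)
  moreover from * have "\<forall>\<pi> M. bij \<pi> \<longrightarrow> (\<Sum>(A, B) | A + B = image_mset \<pi> M. f A * g B) =
      (\<Sum>(A, B) | A + B = M. f A * g B)"
    by (simp add: sum_add_decomp_image)
  ultimately show "(\<forall>\<pi> M. bij \<pi> \<longrightarrow> (\<Sum>(A, B) | A + B = image_mset \<pi> M. f A * g B) =
      (\<Sum>(A, B) | A + B = M. f A * g B)) \<and>
      (\<exists>d. \<forall>M. size M > d \<longrightarrow> (\<Sum>(A, B) | A + B = M. f A * g B) = 0)"
    by blast
qed

instance
proof
  fix f g h :: sym_fun
  show "f + g + h = f + (g + h)" "f + g = g + f" "0 + f = f" "- f + f = 0"
    by (transfer; simp add: fun_eq_iff)+
  show "f - g = f + - g"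
    by (simp add: minus_sym_fun_def)
  show "(0 :: sym_fun) \<noteq> 1"
    by transfer (auto simp: fun_eq_iff)
  show "f * g * h = f * (g * h)"
  proof (transfer, rule ext)
    fix f g h :: "nat multiset \<Rightarrow> int" and M
    have "(\<Sum>(D, C) | D + C = M. (\<Sum>(A, B) | A + B = D. f A * g B) * h C) =
        (\<Sum>(D, C) | D + C = M. \<Sum>(A, B) | A + B = D. f A * g B * h C)"
      by (simp add: sum_distrib_right case_prod_unfold)
    also have "\<dots> = (\<Sum>(A, D) | A + D = M. \<Sum>(B, C) | B + C = D. f A * g B * h C)"
      by (rule sum_add_decomp_assoc)
    also have "\<dots> = (\<Sum>(A, D) | A + D = M. f A * (\<Sum>(B, C) | B + C = D. g B * h C))"
      by (simp add: sum_distrib_left case_prod_unfold mult.assoc)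
    finally show "(\<Sum>(D, C) | D + C = M. (\<Sum>(A, B) | A + B = D. f A * g B) * h C) =
        (\<Sum>(A, D) | A + D = M. f A * (\<Sum>(B, C) | B + C = D. g B * h C))" .
  qed
  show "f * g = g * f"
    by (transfer, rule ext, rule sum.reindex_bij_witness[where i = prod.swap and j = prod.swap])
       (auto simp: add.commute)
  show "1 * f = f"
  proof (transfer, rule ext)
    fix f :: "nat multiset \<Rightarrow> int" and M
    have "(\<Sum>(A, B) | A + B = M. (if A = {#} then 1 else 0) * f B) =
        (\<Sum>(A, B) \<in> {({#} :: nat multiset, M)}. (if A = {#} then 1 else 0) * f B)"
      by (intro sum.mono_neutral_right finite_add_decomp) (auto split: if_splits)
    then show "(\<Sum>(A, B) | A + B = M. (if A = {#} then 1 else 0) * f B) = f M"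
      by simp
  qed
  show "(f + g) * h = f * h + g * h"
    by (transfer, rule ext) (simp add: case_prod_unfold distrib_right sum.distrib)
qed

end


section \<open>Symmetry from adjacent transpositions\<close>

lemma symmetric_transpose:
  fixes f :: "nat multiset \<Rightarrow> 'b"
  assumes adj: "\<And>t M. f (image_mset (transpose t (Suc t)) M) = f M"
  shows "f (image_mset (transpose a b) M) = f M"
proof -
  have less: "a < b \<Longrightarrow> f (image_mset (transpose a b) M) = f M" for a b M
  proof (induction b arbitrary: M)
    case (Suc b)
    show ?case
    proof (cases "a = b")
      case False
      with Suc have "a < b" by simp
      then have "transpose a (Suc b) = transpose b (Suc b) \<circ> (transpose a b \<circ> transpose b (Suc b))"
        by (auto simp: fun_eq_iff transpose_def)
      then have "image_mset (transpose a (Suc b)) M = image_mset (transpose b (Suc b))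
          (image_mset (transpose a b) (image_mset (transpose b (Suc b)) M))"
        by (simp add: multiset.map_comp)
      with Suc.IH[OF \<open>a < b\<close>] show ?thesis
        by (simp add: adj)
    qed (simp add: adj)
  qed simp
  show ?thesis
    using less[of a b] less[of b a] by (cases a b rule: linorder_cases) (simp_all add: transpose_commute)
qed

lemma symmetric_bij:
  fixes f :: "nat multiset \<Rightarrow> 'b"
  assumes adj: "\<And>t M. f (image_mset (transpose t (Suc t)) M) = f M"
    and "inj_on \<pi> (set_mset M)"
  shows "f (image_mset \<pi> M) = f M"
  using assms(2)
proof (induction "card {x \<in> set_mset M. \<pi> x \<noteq> x}" arbitrary: \<pi> rule: less_induct)
  case less
  show ?case
  proof (cases "\<exists>x \<in># M. \<pi> x \<noteq> x")
    case False
    then have "image_mset \<pi> M = M"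
      by (metis (no_types, lifting) multiset.map_cong0 multiset.map_ident)
    then show ?thesis by simp
  next
    case True
    then obtain x where x: "x \<in># M" "\<pi> x \<noteq> x" by blast
    define \<sigma> where "\<sigma> = transpose x (\<pi> x) \<circ> \<pi>"
    have "inj_on \<sigma> (set_mset M)"
      unfolding \<sigma>_def using less.prems by (intro comp_inj_on) auto
    moreover have "{y \<in> set_mset M. \<sigma> y \<noteq> y} \<subset> {y \<in> set_mset M. \<pi> y \<noteq> y}"
    proof
      show "{y \<in> set_mset M. \<sigma> y \<noteq> y} \<subseteq> {y \<in> set_mset M. \<pi> y \<noteq> y}"
        using x less.prems by (auto simp: \<sigma>_def transpose_def inj_on_def)
      show "{y \<in> set_mset M. \<sigma> y \<noteq> y} \<noteq> {y \<in> set_mset M. \<pi> y \<noteq> y}"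
        using x unfolding set_eq_iff by (intro notI) (auto simp: \<sigma>_def dest: spec[of _ x])
    qed
    then have "card {y \<in> set_mset M. \<sigma> y \<noteq> y} < card {y \<in> set_mset M. \<pi> y \<noteq> y}"
      by (intro psubset_card_mono) auto
    ultimately have "f (image_mset \<sigma> M) = f M"
      by (intro less.hyps)
    moreover have "image_mset \<sigma> M = image_mset (transpose x (\<pi> x)) (image_mset \<pi> M)"
      by (simp add: \<sigma>_def multiset.map_comp)
    ultimately show ?thesis
      by (simp add: symmetric_transpose[of f, OF adj])
  qed
qed


section \<open>Semistandard tableaux\<close>

text \<open>
  Partitions are weakly decreasing lists in which trailing zero parts are allowed; see
  \<open>schur_append_zero\<close> below. A tableau is the list of its rows, from top to bottom.
\<close>

definition is_partition :: "nat list \<Rightarrow> bool" where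
  "is_partition \<mu> \<longleftrightarrow> sorted_wrt (\<ge>) \<mu>"

definition ssyt :: "nat list \<Rightarrow> nat list list set" where
  "ssyt \<mu> = {T. is_partition \<mu> \<and> map length T = \<mu> \<and>
     (\<forall>R \<in> set T. sorted R) \<and>
     (\<forall>i j. Suc i < length T \<longrightarrow> j < length (T ! Suc i) \<longrightarrow> T ! i ! j < T ! Suc i ! j)}"

subsection \<open>The Bender-Knuth involution\<close>

definition num_less :: "nat list \<Rightarrow> nat \<Rightarrow> nat" where
  "num_less R t = length (filter (\<lambda>x. x < t) R)"

lemma num_less_Suc: "num_less R (Suc t) = num_less R t + count (mset R) t"
  unfolding num_less_def by (induction R) (auto simp: less_Suc_eq)

lemma num_less_mono: "s \<le> t \<Longrightarrow> num_less R s \<le> num_less R t"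
  unfolding num_less_def by (induction R) auto

lemma num_less_append: "num_less (R @ S) t = num_less R t + num_less S t"
  by (simp add: num_less_def)

lemma num_less_replicate: "num_less (replicate n x) t = (if x < t then n else 0)"
  by (simp add: num_less_def)

lemma num_less_concat: "num_less (concat T) t = (\<Sum>i<length T. num_less (T ! i) t)"
  by (induction T rule: rev_induct) (simp_all add: num_less_append nth_append num_less_def[of "[]"])

lemma nth_less_iff_num_less:
  assumes "sorted R" "j < length R"
  shows "R ! j < t \<longleftrightarrow> j < num_less R t"
  using assms
proof (induction R arbitrary: j)
  case (Cons x R)
  show ?case
  proof (cases "x < t")
    case True
    with Cons show ?thesis
      by (cases j) (auto simp: num_less_def)
  next
    case False
    with Cons.prems have "filter (\<lambda>y. y < t) (x # R) = []"
      by (auto simp: filter_empty_conv)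
    moreover have "x \<le> (x # R) ! j"
      using Cons.prems by (cases j) auto
    ultimately show ?thesis
      using False by (auto simp: num_less_def)
  qed
qed simp

lemma column_strict_iff:
  assumes "sorted R" "sorted S" "length S \<le> length R"
  shows "(\<forall>j < length S. R ! j < S ! j) \<longleftrightarrow> (\<forall>t. num_less S (Suc t) \<le> num_less R t)"
proof (intro iffI allI impI)
  fix t
  assume *: "\<forall>j < length S. R ! j < S ! j"
  show "num_less S (Suc t) \<le> num_less R t"
  proof (rule ccontr)
    define j where "j = num_less R t"
    assume "\<not> ?thesis"
    then have j: "j < num_less S (Suc t)" by (simp add: j_def)
    moreover have "num_less S (Suc t) \<le> length S" by (simp add: num_less_def)
    ultimately have "j < length S" by simp
    then have "S ! j < Suc t" "R ! j < S ! j"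
      using * j nth_less_iff_num_less[OF assms(2)] by auto
    then have "R ! j < t" by simp
    then show False
      using nth_less_iff_num_less[OF assms(1), of j t] \<open>j < length S\<close> assms(3) by (simp add: j_def)
  qed
next
  fix j
  assume *: "\<forall>t. num_less S (Suc t) \<le> num_less R t" and j: "j < length S"
  have "j < num_less S (Suc (S ! j))"
    using nth_less_iff_num_less[OF assms(2) j] by auto
  then have "j < num_less R (S ! j)"
    using * less_le_trans by blast
  then show "R ! j < S ! j"
    using nth_less_iff_num_less[OF assms(1), of j] j assms(3) by simp
qed

lemma ssyt_iff:
  "T \<in> ssyt \<mu> \<longleftrightarrow> is_partition \<mu> \<and> map length T = \<mu> \<and> (\<forall>R \<in> set T. sorted R) \<and>
     (\<forall>i t. Suc i < length T \<longrightarrow> num_less (T ! Suc i) (Suc t) \<le> num_less (T ! i) t)"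
proof -
  have "(\<forall>j < length (T ! Suc i). T ! i ! j < T ! Suc i ! j) \<longleftrightarrow>
      (\<forall>t. num_less (T ! Suc i) (Suc t) \<le> num_less (T ! i) t)"
    if "is_partition (map length T)" "\<forall>R \<in> set T. sorted R" "Suc i < length T" for i
  proof (rule column_strict_iff)
    from that(1,3) have "map length T ! i \<ge> map length T ! Suc i"
      unfolding is_partition_def by (auto simp: sorted_wrt_iff_nth_less)
    with that(3) show "length (T ! Suc i) \<le> length (T ! i)" by simp
  qed (use that in auto)
  then show ?thesis
    unfolding ssyt_def by blast
qed

lemma sorted_eqI_num_less:
  assumes "sorted R" "sorted S" "\<And>t. num_less R t = num_less S t"
  shows "R = S"
proof -
  have "count (mset R) t = count (mset S) t" for t
    using assms(3)[of t] assms(3)[of "Suc t"] by (simp add: num_less_Suc)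
  then have "mset R = mset S"
    by (simp add: multiset_eq_iff)
  with assms(1,2) show ?thesis
    by (metis properties_for_sort)
qed

definition bk_row :: "nat \<Rightarrow> nat \<Rightarrow> nat list \<Rightarrow> nat list" where
  "bk_row t v R = filter (\<lambda>x. x < t) R @ replicate (v - num_less R t) t @
     replicate (num_less R (t + 2) - v) (t + 1) @ filter (\<lambda>x. x \<ge> t + 2) R"

lemma
  assumes "sorted R" "num_less R t \<le> v" "v \<le> num_less R (t + 2)"
  shows sorted_bk_row: "sorted (bk_row t v R)"
    and length_bk_row: "length (bk_row t v R) = length R"
    and num_less_bk_row: "num_less (bk_row t v R) u = (if u = t + 1 then v else num_less R u)"
proof -
  show "sorted (bk_row t v R)"
    using assms(1) by (auto simp: bk_row_def sorted_append sorted_wrt_filter)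
  have *: "length (filter (\<lambda>x. x \<ge> t + 2) R) = length R - num_less R (t + 2)"
    using sum_length_filter_compl[of "\<lambda>x. x < t + 2" R] by (simp add: num_less_def not_less)
  moreover have "num_less R (t + 2) \<le> length R"
    by (simp add: num_less_def)
  ultimately show "length (bk_row t v R) = length R"
    using assms(2,3) by (simp add: bk_row_def flip: num_less_def)
  define lo hi where "lo = filter (\<lambda>x. x < t) R" and "hi = filter (\<lambda>x. x \<ge> t + 2) R"
  have bk_row: "bk_row t v R = lo @ replicate (v - num_less R t) t @
      replicate (num_less R (t + 2) - v) (t + 1) @ hi"
    by (simp add: bk_row_def lo_def hi_def)
  have a: "num_less lo u = num_less R (min t u)"
    by (auto simp: lo_def num_less_def intro!: arg_cong[where f = length] filter_cong)
  have b: "num_less hi u = num_less R u - num_less R (t + 2)"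
  proof (cases "u \<le> t + 2")
    case True
    then show ?thesis
      using num_less_mono[OF True, of R] by (auto simp: hi_def num_less_def filter_empty_conv)
  next
    case False
    have "num_less R u = num_less (filter (\<lambda>x. x < t + 2) R) u + num_less (filter (\<lambda>x. \<not> x < t + 2) R) u"
      unfolding num_less_def by (induction R) auto
    moreover have "num_less (filter (\<lambda>x. x < t + 2) R) u = num_less R (t + 2)"
      using False by (auto simp: num_less_def intro!: arg_cong[where f = length] filter_cong)
    ultimately show ?thesis
      by (simp add: hi_def not_less)
  qed
  consider "u \<le> t" | "u = t + 1" | "u \<ge> t + 2" by linarith
  then show "num_less (bk_row t v R) u = (if u = t + 1 then v else num_less R u)"
  proof cases
    case 1
    then show ?thesis
      using num_less_mono[of u "t + 2" R]
      by (simp add: bk_row num_less_append num_less_replicate a b)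
  next
    case 2
    then show ?thesis
      using num_less_mono[of u "t + 2" R] assms a b
      by (simp add: bk_row num_less_append num_less_replicate a b)
  next
    case 3
    then show ?thesis
      using num_less_mono[of "t + 2" u R] assms
      by (simp add: bk_row num_less_append num_less_replicate a b)
  qed
qed

definition bk_low :: "nat \<Rightarrow> nat list list \<Rightarrow> nat \<Rightarrow> nat" where
  "bk_low t T i = (if Suc i < length T
     then max (num_less (T ! i) t) (num_less (T ! Suc i) (t + 2)) else num_less (T ! i) t)"

definition bk_high :: "nat \<Rightarrow> nat list list \<Rightarrow> nat \<Rightarrow> nat" where
  "bk_high t T i = (case i of 0 \<Rightarrow> num_less (T ! i) (t + 2)
     | Suc h \<Rightarrow> min (num_less (T ! h) t) (num_less (T ! i) (t + 2)))"

definition bk :: "nat \<Rightarrow> nat list list \<Rightarrow> nat list list" where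
  "bk t T = map (\<lambda>i. bk_row t (bk_low t T i + bk_high t T i - num_less (T ! i) (t + 1)) (T ! i))
     [0..<length T]"

lemma sum_bk_low_high:
  "(\<Sum>i<length T. bk_low t T i + bk_high t T i) =
     (\<Sum>i<length T. num_less (T ! i) t + num_less (T ! i) (t + 2))"
proof (cases "length T")
  case (Suc n)
  have "(\<Sum>i<n. bk_low t T i + bk_high t T (Suc i)) =
      (\<Sum>i<n. num_less (T ! i) t + num_less (T ! Suc i) (t + 2))"
    by (rule sum.cong) (auto simp: bk_low_def bk_high_def Suc)
  moreover have "(\<Sum>i<Suc n. bk_high t T i) = bk_high t T 0 + (\<Sum>i<n. bk_high t T (Suc i))"
    "(\<Sum>i<Suc n. num_less (T ! i) (t + 2)) =
      num_less (T ! 0) (t + 2) + (\<Sum>i<n. num_less (T ! Suc i) (t + 2))"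
    by (rule sum.lessThan_Suc_shift)+
  moreover have "bk_high t T 0 = num_less (T ! 0) (t + 2)" "bk_low t T n = num_less (T ! n) t"
    by (simp_all add: bk_high_def bk_low_def Suc)
  ultimately show ?thesis
    by (simp add: Suc sum.distrib)
qed simp

context
  fixes T :: "nat list list" and \<mu> :: "nat list" and t :: nat
  assumes T: "T \<in> ssyt \<mu>"
begin

private lemma T_strict: "Suc i < length T \<Longrightarrow> num_less (T ! Suc i) (Suc u) \<le> num_less (T ! i) u"
  using T by (simp add: ssyt_iff)

private lemma low_le: "i < length T \<Longrightarrow> bk_low t T i \<le> num_less (T ! i) (t + 1)"
  using T_strict[of i "t + 1"] num_less_mono[of t "t + 1" "T ! i"] by (simp add: bk_low_def)

private lemma le_high: "i < length T \<Longrightarrow> num_less (T ! i) (t + 1) \<le> bk_high t T i"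
  using T_strict[of "i - 1" t] num_less_mono[of "t + 1" "t + 2" "T ! i"]
  by (auto simp: bk_high_def split: nat.split)

private lemma low_high_bounds:
  "num_less (T ! i) t \<le> bk_low t T i" "bk_high t T i \<le> num_less (T ! i) (t + 2)"
  by (auto simp: bk_low_def bk_high_def split: nat.split)

private lemma bk_props:
  assumes "i < length T"
  shows "sorted (bk t T ! i)" "length (bk t T ! i) = length (T ! i)"
    "num_less (bk t T ! i) u = (if u = t + 1
       then bk_low t T i + bk_high t T i - num_less (T ! i) (t + 1) else num_less (T ! i) u)"
proof -
  have "sorted (T ! i)"
    using T assms by (simp add: ssyt_iff)
  moreover have "num_less (T ! i) t \<le> bk_low t T i + bk_high t T i - num_less (T ! i) (t + 1)"
    "bk_low t T i + bk_high t T i - num_less (T ! i) (t + 1) \<le> num_less (T ! i) (t + 2)"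
    using low_le[OF assms] le_high[OF assms] low_high_bounds[of i] by linarith+
  ultimately show "sorted (bk t T ! i)" "length (bk t T ! i) = length (T ! i)"
    "num_less (bk t T ! i) u = (if u = t + 1
       then bk_low t T i + bk_high t T i - num_less (T ! i) (t + 1) else num_less (T ! i) u)"
    using assms by (simp_all add: bk_def sorted_bk_row length_bk_row num_less_bk_row)
qed

private lemma length_bk: "length (bk t T) = length T"
  by (simp add: bk_def)

lemma bk_in_ssyt: "bk t T \<in> ssyt \<mu>"
proof -
  have "num_less (bk t T ! Suc i) (Suc u) \<le> num_less (bk t T ! i) u" if i: "Suc i < length T" for i u
  proof -
    have "bk_high t T (Suc i) \<le> num_less (T ! i) t" "num_less (T ! Suc i) (t + 2) \<le> bk_low t T i"
      using i by (simp_all add: bk_low_def bk_high_def)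
    then show ?thesis
      using i low_le[of i] low_le[of "Suc i"] le_high[of i] le_high[of "Suc i"] T_strict[OF i, of u]
      by (auto simp: bk_props)
  qed
  moreover have "map length (bk t T) = map length T"
    by (auto simp: list_eq_iff_nth_eq length_bk bk_props)
  moreover have "\<forall>R \<in> set (bk t T). sorted R"
    by (auto simp: in_set_conv_nth length_bk bk_props)
  ultimately show ?thesis
    using T by (simp add: ssyt_iff length_bk)
qed

lemma mset_concat_bk: "mset (concat (bk t T)) = image_mset (transpose t (Suc t)) (mset (concat T))"
proof -
  let ?M = "mset (concat T)" and ?M' = "mset (concat (bk t T))"
  have eq: "num_less (concat (bk t T)) u = num_less (concat T) u" if "u \<noteq> t + 1" for u
    using that by (simp add: num_less_concat length_bk bk_props)
  have "(\<Sum>i<length T. num_less (bk t T ! i) (t + 1) + num_less (T ! i) (t + 1)) =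
      (\<Sum>i<length T. bk_low t T i + bk_high t T i)"
  proof (rule sum.cong)
    fix i
    assume "i \<in> {..<length T}"
    then show "num_less (bk t T ! i) (t + 1) + num_less (T ! i) (t + 1) =
        bk_low t T i + bk_high t T i"
      using le_high[of i] by (simp add: bk_props)
  qed simp
  then have mid: "num_less (concat (bk t T)) (t + 1) + num_less (concat T) (t + 1) =
      num_less (concat T) t + num_less (concat T) (t + 2)"
    unfolding sum_bk_low_high by (simp add: num_less_concat length_bk sum.distrib)
  have Suc: "num_less (concat T) (u + 1) = num_less (concat T) u + count ?M u"
    "num_less (concat (bk t T)) (u + 1) = num_less (concat (bk t T)) u + count ?M' u" for u
    using num_less_Suc[of _ u] by simp_all
  have "t + 1 + 1 = t + 2" "t \<noteq> t + 1" "t + 2 \<noteq> t + 1"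
    by simp_all
  note * = eq[OF this(2)] eq[OF this(3)] mid Suc[of t] Suc[of "t + 1", unfolded this(1)]
  from * have low: "count ?M' t = count ?M (t + 1)"
    by linarith
  from * have high: "count ?M' (t + 1) = count ?M t"
    by linarith
  have M': "count ?M' u = count ?M (transpose t (Suc t) u)" for u
  proof -
    consider "u = t" | "u = t + 1" | "u \<noteq> t" "u \<noteq> t + 1" by blast
    then show ?thesis
    proof cases
      case 1
      with low show ?thesis by (simp del: mset_concat)
    next
      case 2
      with high show ?thesis by (simp del: mset_concat)
    next
      case 3
      then have "count ?M' u = count ?M u"
        using eq[of u] eq[of "u + 1"] Suc[of u] by linarith
      with 3 show ?thesis by (simp del: mset_concat)
    qed
  qed
  have img: "count (image_mset (transpose t (Suc t)) M) u = count M (transpose t (Suc t) u)" for M u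
  proof (induction M)
    case (add x M)
    have "transpose t (Suc t) x = u \<longleftrightarrow> x = transpose t (Suc t) u"
      by (metis transpose_involutory)
    with add show ?case by auto
  qed simp
  show ?thesis
    by (rule multiset_eqI) (simp only: M' img)
qed

lemma bk_bk: "bk t (bk t T) = T"
proof -
  have same: "bk_low t (bk t T) i = bk_low t T i" "bk_high t (bk t T) i = bk_high t T i"
    if "i < length T" for i
    using that by (auto simp: bk_low_def bk_high_def length_bk bk_props split: nat.split)
  show ?thesis
  proof (rule nth_equalityI)
    fix i
    assume "i < length (bk t (bk t T))"
    then have i: "i < length T"
      by (simp add: bk_def)
    let ?v = "bk_low t T i + bk_high t T i - num_less (bk t T ! i) (t + 1)"
    have v: "?v = num_less (T ! i) (t + 1)"
      using i low_le[of i] le_high[of i] by (simp add: bk_props)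
    have bkbk: "bk t (bk t T) ! i = bk_row t ?v (bk t T ! i)"
      using i by (simp add: bk_def[of t "bk t T"] length_bk same)
    have bounds: "num_less (bk t T ! i) t \<le> ?v" "?v \<le> num_less (bk t T ! i) (t + 2)"
      unfolding v using i by (simp_all add: bk_props num_less_mono)
    show "bk t (bk t T) ! i = T ! i"
      unfolding bkbk
    proof (rule sorted_eqI_num_less)
      show "sorted (bk_row t ?v (bk t T ! i))"
        by (rule sorted_bk_row) (use bk_props[OF i] bounds in auto)
      show "sorted (T ! i)"
        using T i by (simp add: ssyt_iff)
      show "num_less (bk_row t ?v (bk t T ! i)) u = num_less (T ! i) u" for u
        using num_less_bk_row[OF bk_props(1)[OF i] bounds, of u] v i by (simp add: bk_props)
    qed
  qed (simp add: bk_def)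
qed

end

lemma card_ssyt_transpose:
  "card {T \<in> ssyt \<mu>. mset (concat T) = image_mset (transpose t (Suc t)) M} =
     card {T \<in> ssyt \<mu>. mset (concat T) = M}"
proof (rule bij_betw_same_card[of "bk t"], rule bij_betw_byWitness[where f' = "bk t"])
  have "image_mset (transpose t (Suc t)) (image_mset (transpose t (Suc t)) M) = M"
    by (simp add: multiset.map_comp)
  then show "bk t ` {T \<in> ssyt \<mu>. mset (concat T) = image_mset (transpose t (Suc t)) M} \<subseteq>
      {T \<in> ssyt \<mu>. mset (concat T) = M}"
    using bk_in_ssyt mset_concat_bk by fastforce
  show "bk t ` {T \<in> ssyt \<mu>. mset (concat T) = M} \<subseteq>
      {T \<in> ssyt \<mu>. mset (concat T) = image_mset (transpose t (Suc t)) M}"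
    using bk_in_ssyt mset_concat_bk by fastforce
qed (use bk_bk in blast)+


section \<open>Schur functions\<close>

text \<open>
  The coefficient of a monomial in \<open>schur \<mu>\<close> is the number of semistandard tableaux of shape
  \<open>\<mu>\<close> whose entries are the indices of that monomial. If \<open>\<mu>\<close> is not weakly decreasing,
  there are no tableaux and \<open>schur \<mu> = 0\<close>.
\<close>

lift_definition schur :: "nat list \<Rightarrow> sym_fun" is
  "\<lambda> \<mu> M. int (card {T \<in> ssyt \<mu>. mset (concat T) = M})"
proof
  fix \<mu> :: "nat list"
  define F where "F M = int (card {T \<in> ssyt \<mu>. mset (concat T) = M})" for M
  have "F (image_mset (transpose t (Suc t)) M) = F M" for t M
    unfolding F_def card_ssyt_transpose ..
  then have "F (image_mset \<pi> M) = F M" if "bij \<pi>" for \<pi> M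
    by (rule symmetric_bij) (use that in \<open>auto simp: bij_def intro: inj_on_subset\<close>)
  then show "\<forall>\<pi> M. bij \<pi> \<longrightarrow> int (card {T \<in> ssyt \<mu>. mset (concat T) = image_mset \<pi> M}) =
      int (card {T \<in> ssyt \<mu>. mset (concat T) = M})"
    unfolding F_def by blast
  have "size (mset (concat T)) = sum_list \<mu>" if "T \<in> ssyt \<mu>" for T
    using that by (auto simp: ssyt_def length_concat)
  then have "{T \<in> ssyt \<mu>. mset (concat T) = M} = {}" if "size M > sum_list \<mu>" for M
    using that by auto
  then show "\<exists>d. \<forall>M. size M > d \<longrightarrow> int (card {T \<in> ssyt \<mu>. mset (concat T) = M}) = 0"
    by (metis card.empty of_nat_0)
qed

lemma schur_append_zero:
  assumes "is_partition \<mu>"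
  shows "schur (\<mu> @ [0]) = schur \<mu>"
proof -
  have in_iff: "T @ [[]] \<in> ssyt (\<mu> @ [0]) \<longleftrightarrow> T \<in> ssyt \<mu>" for T
    using assms
    by (auto simp: ssyt_iff is_partition_def sorted_wrt_append nth_append num_less_def[of "[]"])
  have ex: "\<exists>S. T = S @ [[]] \<and> S \<in> ssyt \<mu>" if "T \<in> ssyt (\<mu> @ [0])" for T
  proof -
    from that have "map length T = \<mu> @ [0]" by (simp add: ssyt_def)
    then obtain S where "T = S @ [[]]"
      by (auto simp: map_eq_append_conv)
    with that in_iff show ?thesis by blast
  qed
  show ?thesis
  proof (transfer fixing: \<mu>, rule ext)
    fix M
    have "bij_betw (\<lambda>T. T @ [[]]) {T \<in> ssyt \<mu>. mset (concat T) = M}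
        {T \<in> ssyt (\<mu> @ [0]). mset (concat T) = M}"
    proof (rule bij_betw_imageI)
      show "(\<lambda>T. T @ [[]]) ` {T \<in> ssyt \<mu>. mset (concat T) = M} =
          {T \<in> ssyt (\<mu> @ [0]). mset (concat T) = M}"
      proof (intro equalityI subsetI)
        fix T
        assume "T \<in> {T \<in> ssyt (\<mu> @ [0]). mset (concat T) = M}"
        then show "T \<in> (\<lambda>T. T @ [[]]) ` {T \<in> ssyt \<mu>. mset (concat T) = M}"
          using ex[of T] by auto
      qed (auto simp: in_iff)
    qed (simp add: inj_on_def)
    then show "int (card {T \<in> ssyt (\<mu> @ [0]). mset (concat T) = M}) =
        int (card {T \<in> ssyt \<mu>. mset (concat T) = M})"
      by (simp add: bij_betw_same_card)
  qed
qed


section \<open>Near-rectangular partitions\<close>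

text \<open>
  \<open>near_rect r p l k\<close> is \<open>[r|p]\<^sup>l\<^sub>k = ((p + 1)\<^sup>l, p\<^bsup>r-l\<^esup>, k)\<close>, for \<open>l \<le> r\<close> and \<open>k \<le> p\<close>. Omitting an
  index amounts to setting it to zero.
\<close>

definition near_rect :: "nat \<Rightarrow> nat \<Rightarrow> nat \<Rightarrow> nat \<Rightarrow> nat list" where
  "near_rect r p l k = replicate l (p + 1) @ replicate (r - l) p @ [k]"

lemma sorted_wrt_ge_replicate: "sorted_wrt (\<ge>) (replicate n (x :: nat))"
  by (induction n) auto

lemma is_partition_near_rect: "k \<le> p \<Longrightarrow> is_partition (near_rect r p l k)"
  by (auto simp: near_rect_def is_partition_def sorted_wrt_append sorted_wrt_ge_replicate)

end

theory Submission
  imports Defs "Jordan_Normal_Form.Determinant" "HOL-Library.Poly_Mapping"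
begin

text \<open>
  In finitely many variables \<open>s\<^sub>\<mu>\<close> is the Jacobi-Trudi determinant, whose rows depend only on
  the numbers \<open>\<mu>\<^sub>i + n - i\<close>. Written with \<open>r + 1\<close> parts, the six partitions consist of a common
  set of \<open>r - 1\<close> such numbers and two of four further ones, so that the identity is a three-term
  Pluecker relation between maximal minors. The Jacobi-Trudi formula is proved by induction on the
  number of variables: removing the largest entry from a tableau leaves a tableau whose shape
  differs by a horizontal strip, and bidiagonal row operations followed by multilinearity give the
  same recursion for the determinants.
\<close>

section \<open>The three-term Pluecker relation\<close>

text \<open>With a list of rows, moving or replacing a row is a list operation. Rows are functions
  on all of \<open>nat\<close>; only their first \<open>length V\<close> values enter.\<close>

definition rows_det :: "(nat \<Rightarrow> 'a :: comm_ring_1) list \<Rightarrow> 'a" where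
  "rows_det V = det (mat (length V) (length V) (\<lambda>(i, j). (V ! i) j))"

lemma rows_det_swap: "rows_det (X @ v # w # Y) = - rows_det (X @ w # v # Y)"
proof -
  let ?n = "length X + 2 + length Y"
  let ?A = "mat ?n ?n (\<lambda>(i, j). ((X @ w # v # Y) ! i) j)"
  have "mat ?n ?n (\<lambda>(i, j). ((X @ v # w # Y) ! i) j) = swaprows (length X) (Suc (length X)) ?A"
    by (rule eq_matI) (auto simp: mat_swaprows_def nth_append nth_Cons split: nat.splits)
  moreover have "det (swaprows (length X) (Suc (length X)) ?A) = - det ?A"
    by (rule det_swaprows[of _ ?n]) auto
  ultimately show ?thesis
    by (simp add: rows_det_def)
qed

lemma rows_det_move: "rows_det (X @ v # Y @ Z) = (- 1) ^ length Y * rows_det (X @ Y @ v # Z)"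
proof (induction Y arbitrary: X)
  case (Cons y Y)
  from Cons.IH[of "X @ [y]"] show ?case
    by (simp add: rows_det_swap[of X v y])
qed simp

lemma rows_det_not_distinct:
  assumes "\<not> distinct V"
  shows "rows_det V = 0"
proof -
  from assms obtain i j where ij: "i < length V" "j < length V" "i \<noteq> j" "V ! i = V ! j"
    by (auto simp: distinct_conv_nth)
  show ?thesis
    unfolding rows_det_def by (rule det_identical_rows[of _ "length V" i j]) (use ij in auto)
qed

text \<open>The constants \<open>C j\<close> are the cofactors along the row \<open>v\<close>, which
  do not involve \<open>v\<close>.\<close>

lemma rows_det_linear:
  "\<exists>C. \<forall>v. rows_det (X @ v # Y) = (\<Sum>j<Suc (length X + length Y). v j * C j)"
proof -
  let ?n = "Suc (length X + length Y)" and ?k = "length X"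
  let ?A = "\<lambda>v. mat ?n ?n (\<lambda>(i, j). ((X @ v # Y) ! i) j)"
  have "rows_det (X @ v # Y) = (\<Sum>j<?n. v j * cofactor (?A undefined) ?k j)" for v
  proof -
    have "cofactor (?A v) ?k j = cofactor (?A undefined) ?k j" if "j < ?n" for j
    proof -
      have "mat_delete (?A v) ?k j = mat_delete (?A undefined) ?k j"
        by (rule eq_matI) (use that in \<open>auto simp: mat_delete_def nth_append nth_Cons split: nat.splits\<close>)
      then show ?thesis by (simp add: cofactor_def)
    qed
    moreover have "rows_det (X @ v # Y) = (\<Sum>j<?n. ?A v $$ (?k, j) * cofactor (?A v) ?k j)"
      unfolding rows_det_def by (subst laplace_expansion_row[of _ ?n ?k]) auto
    ultimately show ?thesis
      by (auto intro!: sum.cong)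
  qed
  then show ?thesis by blast
qed

text \<open>
  The alternating sum is the Laplace expansion along the first column of a square matrix
  whose first column occurs twice.
\<close>

lemma rows_det_cramer:
  assumes "length V = Suc n" "j < n"
  shows "(\<Sum>i<Suc n. (- 1) ^ i * rows_det (take i V @ drop (Suc i) V) * (V ! i) j) = 0"
proof -
  let ?A = "mat (Suc n) (Suc n) (\<lambda>(i, m). (V ! i) (case m of 0 \<Rightarrow> j | Suc m \<Rightarrow> m))"
  have "cofactor ?A i 0 = (- 1) ^ i * rows_det (take i V @ drop (Suc i) V)" if "i < Suc n" for i
  proof -
    have "mat_delete ?A i 0 = mat n n (\<lambda>(k, m). ((take i V @ drop (Suc i) V) ! k) m)"
      by (rule eq_matI) (use that assms in \<open>auto simp: mat_delete_def nth_append\<close>)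
    then show ?thesis
      using that assms by (simp add: cofactor_def rows_det_def)
  qed
  moreover have "det ?A = (\<Sum>i<Suc n. ?A $$ (i, 0) * cofactor ?A i 0)"
    by (rule laplace_expansion_column) auto
  moreover have "det ?A = 0"
    by (rule det_identical_columns[of _ "Suc n" 0 "Suc j"]) (use assms in \<open>auto intro!: eq_vecI\<close>)
  ultimately show ?thesis
    by (simp add: mult.commute del: sum.lessThan_Suc)
qed

text \<open>By linearity the second factor combines the entries of \<open>V ! i\<close> with
  coefficients independent of \<open>i\<close>. After exchanging the sums,
  \<open>rows_det_cramer\<close> annihilates each column.\<close>

lemma rows_det_plucker:
  assumes "length V = Suc n" "Suc (length X + length Y) = n"
  shows "(\<Sum>i<Suc n. (- 1) ^ i * rows_det (take i V @ drop (Suc i) V) * rows_det (X @ V ! i # Y)) = 0"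
proof -
  from rows_det_linear[of X Y] assms(2) obtain C where
    C: "\<And>v. rows_det (X @ v # Y) = (\<Sum>j<n. v j * C j)"
    by metis
  let ?a = "\<lambda>i. (- 1) ^ i * rows_det (take i V @ drop (Suc i) V)"
  have "(\<Sum>i<Suc n. ?a i * rows_det (X @ V ! i # Y)) = (\<Sum>i<Suc n. \<Sum>j<n. ?a i * (V ! i) j * C j)"
    by (simp only: C sum_distrib_left mult.assoc)
  also have "\<dots> = (\<Sum>j<n. (\<Sum>i<Suc n. ?a i * (V ! i) j) * C j)"
    by (subst sum.swap) (simp only: sum_distrib_right)
  also have "\<dots> = 0"
    using rows_det_cramer[OF assms(1)] by (intro sum.neutral) (simp del: sum.lessThan_Suc)
  finally show ?thesis .
qed

text \<open>In the Pluecker sum over the rows of \<open>V\<close>, a row from \<open>A\<close> or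
  \<open>B\<close> would occur twice in the second factor, so only \<open>d\<close>,
  \<open>c\<close> and \<open>k\<close> contribute.\<close>

lemma rows_det_three_term:
  "rows_det (d # A @ B @ [k]) * rows_det (A @ c # B @ [z]) =
     rows_det (A @ B @ [k, z]) * rows_det (d # A @ c # B) +
     rows_det (A @ c # B @ [k]) * rows_det (d # A @ B @ [z])"
proof -
  define V where "V = d # A @ c # B @ [k]"
  let ?a = "length A" and ?b = "length B"
  let ?n = "Suc (Suc (?a + ?b))"
  define t where "t i = (- 1) ^ i * rows_det (take i V @ drop (Suc i) V) * rows_det (A @ V ! i # B @ [z])" for i
  have "t i = 0" if "i < Suc ?n" "i \<notin> {0, Suc ?a, ?n}" for i
  proof -
    have "V ! i \<in> set A \<union> set B"
      using that by (auto simp: V_def nth_append nth_Cons split: nat.splits)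
    then show ?thesis
      unfolding t_def by (subst rows_det_not_distinct[of "A @ V ! i # B @ [z]"]) auto
  qed
  then have "(\<Sum>i<Suc ?n. t i) = (\<Sum>i\<in>{0, Suc ?a, ?n}. t i)"
    by (intro sum.mono_neutral_right) (auto simp del: sum.lessThan_Suc)
  moreover have "(\<Sum>i<Suc ?n. t i) = 0"
    unfolding t_def by (rule rows_det_plucker) (auto simp: V_def)
  ultimately have "t 0 + t (Suc ?a) + t ?n = 0"
    by (simp del: sum.lessThan_Suc add: add.assoc)
  \<comment> \<open>Moving \<open>d\<close> before \<open>A\<close> and \<open>k\<close> behind
    \<open>B\<close> gives the required row orders. The sign of the second move cancels against the
    position of \<open>k\<close>, which leaves a common factor \<open>(- 1) ^ ?a\<close>.\<close>
  moreover have "rows_det (A @ d # B @ [z]) = (- 1) ^ ?a * rows_det (d # A @ B @ [z])"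
    "rows_det (A @ k # B @ [z]) = (- 1) ^ ?b * rows_det (A @ B @ [k, z])"
    using rows_det_move[of "[]" d A "B @ [z]"] rows_det_move[of A k B "[z]"]
    by (simp_all flip: mult.assoc power_add)
  then have "t 0 = (- 1) ^ ?a * (rows_det (A @ c # B @ [k]) * rows_det (d # A @ B @ [z]))"
    "t (Suc ?a) = - ((- 1) ^ ?a * (rows_det (d # A @ B @ [k]) * rows_det (A @ c # B @ [z])))"
    "t ?n = (- 1) ^ ?a * ((- 1) ^ ?b * (- 1) ^ ?b) * (rows_det (A @ B @ [k, z]) * rows_det (d # A @ c # B))"
    by (simp_all add: t_def V_def nth_append power_add mult_ac)
  ultimately have "(- 1) ^ ?a * (rows_det (A @ B @ [k, z]) * rows_det (d # A @ c # B) +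
     rows_det (A @ c # B @ [k]) * rows_det (d # A @ B @ [z]) -
     rows_det (d # A @ B @ [k]) * rows_det (A @ c # B @ [z])) = 0"
    by (simp add: algebra_simps flip: power_add)
  then show ?thesis
    by (cases "even ?a") simp_all
qed


section \<open>Removing the largest entry of a tableau\<close>

definition ssyt_below :: "nat \<Rightarrow> nat list \<Rightarrow> nat list list set" where
  "ssyt_below N \<mu> = {T \<in> ssyt \<mu>. \<forall>e \<in> set (concat T). e < N}"

text \<open>The values of \<open>x\<close> lie in any commutative ring, so that monomials can be
  substituted later.\<close>

definition schur_poly :: "(nat \<Rightarrow> 'a :: comm_ring_1) \<Rightarrow> nat \<Rightarrow> nat list \<Rightarrow> 'a" where
  "schur_poly x N \<mu> = (\<Sum>T\<in>ssyt_below N \<mu>. \<Prod>e\<in>#mset (concat T). x e)"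

lemma finite_ssyt_below: "finite (ssyt_below N \<mu>)"
proof (rule finite_subset)
  let ?R = "{R. set R \<subseteq> {..<N} \<and> length R \<le> sum_list \<mu>}"
  show "ssyt_below N \<mu> \<subseteq> {T. set T \<subseteq> ?R \<and> length T = length \<mu>}"
    by (auto simp: ssyt_below_def ssyt_def intro!: member_le_sum_list)
  show "finite {T. set T \<subseteq> ?R \<and> length T = length \<mu>}"
    by (intro finite_lists_length_eq finite_lists_length_le) simp
qed

text \<open>The possible lengths of row \<open>i\<close> of \<open>\<nu>\<close> when \<open>\<mu>/\<nu>\<close> is a horizontal strip.\<close>

definition strip :: "nat list \<Rightarrow> nat \<Rightarrow> nat set" where
  "strip \<mu> i = {(if Suc i < length \<mu> then \<mu> ! Suc i else 0)..\<mu> ! i}"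

text \<open>The bound \<open>\<mu> ! Suc i\<close> lies between \<open>f (Suc i)\<close> and
  \<open>f i\<close>.\<close>

lemma is_partition_strip:
  assumes "f \<in> (\<Pi>\<^sub>E i\<in>{..<length \<mu>}. strip \<mu> i)"
  shows "is_partition (map f [0..<length \<mu>])"
  unfolding is_partition_def
proof (subst sorted_wrt_iff_nth_Suc_transp)
  have "f (Suc i) \<le> f i" if "Suc i < length \<mu>" for i
    using PiE_mem[OF assms, of i] PiE_mem[OF assms, of "Suc i"] that by (auto simp: strip_def)
  then show "\<forall>i. Suc i < length (map f [0..<length \<mu>]) \<longrightarrow>
      map f [0..<length \<mu>] ! i \<ge> map f [0..<length \<mu>] ! Suc i"
    by simp
qed (auto simp: transp_def)

lemma sorted_filter_less_append:
  "sorted R \<Longrightarrow> \<forall>e \<in> set R. e < Suc N \<Longrightarrow>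
    filter (\<lambda>e. e < N) R @ replicate (length R - num_less R N) N = R"
proof (induction R)
  case (Cons e R)
  show ?case
  proof (cases "e < N")
    case True
    with Cons show ?thesis by (simp add: num_less_def)
  next
    case False
    with Cons.prems have "\<forall>y \<in> set (e # R). y = N" by force
    then have "e # R = replicate (length (e # R)) N"
      by (metis replicate_length_same)
    then obtain m where "e # R = replicate m N" by blast
    then show ?thesis by (simp only: num_less_def) simp
  qed
qed simp

lemma num_less_filter: "num_less (filter (\<lambda>e. e < N) R) t = num_less R (min t N)"
  by (simp add: num_less_def min_def) (auto intro!: arg_cong[where f = length] filter_cong)

lemma num_less_all: "\<forall>e \<in> set R. e < t \<Longrightarrow> num_less R t = length R"
  by (simp add: num_less_def)

lemma num_less_le_length: "num_less R t \<le> length R"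
  by (simp add: num_less_def)

text \<open>Strictness allows at most one \<open>N\<close> in each column, at its bottom, so the
  removed cells form a horizontal strip.\<close>

lemma ssyt_below_cut:
  assumes T: "T \<in> ssyt_below (Suc N) \<mu>"
  defines "f \<equiv> restrict (\<lambda>i. num_less (T ! i) N) {..<length \<mu>}"
  defines "U \<equiv> map (filter (\<lambda>e. e < N)) T"
  shows "f \<in> (\<Pi>\<^sub>E i\<in>{..<length \<mu>}. strip \<mu> i)"
    and "U \<in> ssyt_below N (map f [0..<length \<mu>])"
proof -
  have len: "map length T = \<mu>" and sorted: "\<forall>R \<in> set T. sorted R"
    and strict: "\<And>i t. Suc i < length T \<Longrightarrow> num_less (T ! Suc i) (Suc t) \<le> num_less (T ! i) t"
    using T by (auto simp: ssyt_below_def ssyt_iff)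
  from len have [simp]: "length T = length \<mu>"
    by (metis length_map)
  have nth_len: "length (T ! i) = \<mu> ! i" if "i < length \<mu>" for i
    using that len by (metis length_map nth_map)
  have all: "num_less (T ! i) (Suc N) = \<mu> ! i" if "i < length \<mu>" for i
    using that T nth_len[OF that] by (subst num_less_all) (auto simp: ssyt_below_def)
  show f: "f \<in> (\<Pi>\<^sub>E i\<in>{..<length \<mu>}. strip \<mu> i)"
  proof (rule PiE_I)
    fix i assume "i \<in> {..<length \<mu>}"
    then have i: "i < length \<mu>" by simp
    \<comment> \<open>At \<open>t = N\<close> the condition \<open>strict\<close> counts all of row
      \<open>Suc i\<close>, which gives the lower bound of the strip.\<close>
    with strict[of i N] all[of "Suc i"] num_less_le_length[of "T ! i" N] nth_len[of i]
    show "f i \<in> strip \<mu> i" by (auto simp: strip_def f_def)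
  qed (simp add: f_def)
  have "map length U = map f [0..<length \<mu>]"
    by (rule nth_equalityI) (auto simp: U_def f_def num_less_def)
  moreover have "num_less (U ! Suc i) (Suc t) \<le> num_less (U ! i) t" if "Suc i < length U" for i t
  proof -
    have i: "Suc i < length T" using that by (simp add: U_def)
    show ?thesis
    proof (cases "t < N")
      case True
      with i strict[OF i, of t] show ?thesis
        by (simp add: U_def num_less_filter min_def)
    next
      case False
      with i strict[OF i, of N] num_less_mono[of N "Suc N" "T ! Suc i"] show ?thesis
        by (simp add: U_def num_less_filter min_def)
    qed
  qed
  ultimately show "U \<in> ssyt_below N (map f [0..<length \<mu>])"
    using is_partition_strip[OF f] sorted
    by (auto simp: ssyt_below_def ssyt_iff U_def sorted_filter[where f = id, simplified])
qed

text \<open>The inverse construction: row \<open>i\<close> is refilled with copies of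
  \<open>N\<close>, each contributing a factor \<open>x N\<close>.\<close>

lemma ssyt_below_paste:
  assumes part: "is_partition \<mu>"
    and f: "f \<in> (\<Pi>\<^sub>E i\<in>{..<length \<mu>}. strip \<mu> i)"
    and U: "U \<in> ssyt_below N (map f [0..<length \<mu>])"
  defines "T \<equiv> map (\<lambda>i. U ! i @ replicate (\<mu> ! i - f i) N) [0..<length \<mu>]"
  shows "T \<in> ssyt_below (Suc N) \<mu>"
    and "restrict (\<lambda>i. num_less (T ! i) N) {..<length \<mu>} = f"
    and "map (filter (\<lambda>e. e < N)) T = U"
    and "(\<Prod>e\<in>#mset (concat T). x e) = (\<Prod>i<length \<mu>. x N ^ (\<mu> ! i - f i)) * (\<Prod>e\<in>#mset (concat U). (x e :: 'a :: comm_ring_1))"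
proof -
  have len: "map length U = map f [0..<length \<mu>]" and sorted: "\<forall>R \<in> set U. sorted R"
    and strict: "\<And>i t. Suc i < length U \<Longrightarrow> num_less (U ! Suc i) (Suc t) \<le> num_less (U ! i) t"
    and below: "\<forall>R \<in> set U. \<forall>e \<in> set R. e < N"
    using U by (auto simp: ssyt_below_def ssyt_iff)
  from len have [simp]: "length U = length \<mu>"
    by (metis length_map length_upt minus_nat.diff_0)
  have nth_len: "length (U ! i) = f i" if "i < length \<mu>" for i
    using that len by (metis add_0 length_map length_upt minus_nat.diff_0 nth_map nth_upt)
  have fi: "f i \<le> \<mu> ! i" if "i < length \<mu>" for i
    using PiE_mem[OF f, of i] that by (auto simp: strip_def)
  have fi': "\<mu> ! Suc i \<le> f i" if "Suc i < length \<mu>" for i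
    using PiE_mem[OF f, of i] that by (auto simp: strip_def)
  have below': "\<forall>e \<in> set (U ! i). e < N" if "i < length \<mu>" for i
    using that below by auto
  have num: "num_less (T ! i) t = (if t \<le> N then num_less (U ! i) t else \<mu> ! i)" if "i < length \<mu>" for i t
  proof -
    have "num_less (U ! i) t = f i" if "N < t"
      using that nth_len below' \<open>i < length \<mu>\<close> by (subst num_less_all) fastforce+
    then show ?thesis
      using that fi[OF that] by (auto simp: T_def num_less_append num_less_replicate)
  qed
  have "map length T = \<mu>"
    by (rule nth_equalityI) (auto simp: T_def nth_len fi)
  moreover have "sorted R" if "R \<in> set T" for R
    using that sorted below' by (fastforce simp: T_def sorted_append intro: less_imp_le)
  moreover have "num_less (T ! Suc i) (Suc t) \<le> num_less (T ! i) t" if "Suc i < length T" for i t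
  proof -
    have i: "Suc i < length \<mu>" using that by (simp add: T_def)
    \<comment> \<open>Below \<open>N\<close> the new entries do not count; at \<open>N\<close> the
      strip condition decides; above \<open>N\<close> rows are counted in full.\<close>
    consider "t < N" | "t = N" | "t > N" by linarith
    then show ?thesis
    proof cases
      case 1
      with i strict[of i t] show ?thesis by (simp add: num)
    next
      case 2
      with i fi'[OF i] num_less_all[OF below'[of i]] show ?thesis
        by (simp add: num nth_len)
    next
      case 3
      with i fi'[OF i] fi[of i] show ?thesis by (simp add: num)
    qed
  qed
  moreover have "\<forall>R \<in> set T. \<forall>e \<in> set R. e < Suc N"
    using below' by (auto simp: T_def less_Suc_eq)
  ultimately show "T \<in> ssyt_below (Suc N) \<mu>"
    using part by (auto simp: ssyt_below_def ssyt_iff)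
  have "num_less (T ! i) N = f i" if "i < length \<mu>" for i
    using that num[OF that, of N] num_less_all[OF below'[OF that]] nth_len[OF that] by simp
  then show "restrict (\<lambda>i. num_less (T ! i) N) {..<length \<mu>} = f"
    by (intro ext) (simp add: restrict_def PiE_arb[OF f])
  have "filter (\<lambda>e. e < N) (U ! i) = U ! i" if "i < length \<mu>" for i
    using below'[OF that] by (simp add: filter_id_conv)
  then show "map (filter (\<lambda>e. e < N)) T = U"
    by (intro nth_equalityI) (simp_all add: T_def)
  have prod_concat: "(\<Prod>e\<in>#mset (concat S). x e) = (\<Prod>i<length S. \<Prod>e\<in>#mset (S ! i). x e)" for S
    by (induction S rule: rev_induct) (simp_all add: nth_append)
  show "(\<Prod>e\<in>#mset (concat T). x e) = (\<Prod>i<length \<mu>. x N ^ (\<mu> ! i - f i)) * (\<Prod>e\<in>#mset (concat U). x e)"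
    unfolding prod_concat by (simp add: T_def prod.distrib mult.commute)
qed

text \<open>Cutting and pasting are mutually inverse between tableaux \<open>T\<close> and pairs
  \<open>(f, U)\<close>. Taking \<open>f\<close> extensional makes it unique.\<close>

lemma schur_poly_Suc:
  assumes "is_partition \<mu>"
  shows "schur_poly x (Suc N) \<mu> = (\<Sum>f\<in>(\<Pi>\<^sub>E i\<in>{..<length \<mu>}. strip \<mu> i).
    (\<Prod>i<length \<mu>. x N ^ (\<mu> ! i - f i)) * schur_poly x N (map f [0..<length \<mu>]))"
proof -
  let ?F = "\<Pi>\<^sub>E i\<in>{..<length \<mu>}. strip \<mu> i"
  let ?S = "\<lambda>f. ssyt_below N (map f [0..<length \<mu>])"
  let ?w = "\<lambda>f. \<Prod>i<length \<mu>. x N ^ (\<mu> ! i - f i)"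
  have fin: "finite ?F"
    by (intro finite_PiE) (auto simp: strip_def)
  have "(\<Sum>f\<in>?F. ?w f * schur_poly x N (map f [0..<length \<mu>])) =
      (\<Sum>(f, U)\<in>Sigma ?F ?S. ?w f * (\<Prod>e\<in>#mset (concat U). x e))"
    unfolding schur_poly_def sum_distrib_left
    by (rule sum.Sigma) (use fin finite_ssyt_below in blast)+
  also have "\<dots> = (\<Sum>T\<in>ssyt_below (Suc N) \<mu>. \<Prod>e\<in>#mset (concat T). x e)"
  proof (rule sum.reindex_bij_witness[where
      i = "\<lambda>T. (restrict (\<lambda>i. num_less (T ! i) N) {..<length \<mu>}, map (filter (\<lambda>e. e < N)) T)" and
      j = "\<lambda>(f, U). map (\<lambda>i. U ! i @ replicate (\<mu> ! i - f i) N) [0..<length \<mu>]"], goal_cases)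
    case (3 T)
    then have len: "map length T = \<mu>" and T: "\<forall>R \<in> set T. sorted R \<and> (\<forall>e \<in> set R. e < Suc N)"
      by (auto simp: ssyt_below_def ssyt_iff)
    from len have [simp]: "length T = length \<mu>"
      by (metis length_map)
    have "filter (\<lambda>e. e < N) (T ! i) @ replicate (\<mu> ! i - num_less (T ! i) N) N = T ! i"
      if i: "i < length \<mu>" for i
    proof -
      have "length (T ! i) = \<mu> ! i"
        using i len by (metis length_map nth_map)
      moreover have "T ! i \<in> set T"
        using i by simp
      ultimately show ?thesis
        using T sorted_filter_less_append[of "T ! i" N] by simp
    qed
    then show ?case
      by (auto intro!: nth_equalityI)
  qed (use assms ssyt_below_cut ssyt_below_paste in auto)
  finally show ?thesis
    by (simp add: schur_poly_def)
qed

lemma schur_poly_0: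
  assumes "is_partition \<mu>"
  shows "schur_poly x 0 \<mu> = of_bool (\<forall>i < length \<mu>. \<mu> ! i = 0)"
proof -
  have "ssyt_below 0 \<mu> = (if \<forall>i < length \<mu>. \<mu> ! i = 0 then {replicate (length \<mu>) []} else {})"
  proof (intro equalityI subsetI)
    fix T assume "T \<in> ssyt_below 0 \<mu>"
    then have len: "map length T = \<mu>" and empty: "\<And>R e. R \<in> set T \<Longrightarrow> e \<notin> set R"
      by (auto simp: ssyt_below_def ssyt_def)
    have "R = []" if "R \<in> set T" for R
      using empty[OF that] by (cases R) auto
    with len have T: "T = replicate (length \<mu>) []"
      by (intro replicate_eqI) auto
    then have "\<forall>i < length \<mu>. \<mu> ! i = 0"
      by (subst (2) len[symmetric]) simp
    with T show "T \<in> (if \<forall>i < length \<mu>. \<mu> ! i = 0 then {replicate (length \<mu>) []} else {})"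
      by (subst if_P) auto
  next
    fix T :: "nat list list"
    assume "T \<in> (if \<forall>i < length \<mu>. \<mu> ! i = 0 then {replicate (length \<mu>) []} else {})"
    then have "T = replicate (length \<mu>) []" "\<forall>i < length \<mu>. \<mu> ! i = 0"
      by (auto split: if_splits)
    moreover from this(2) have "map length (replicate (length \<mu>) []) = \<mu>"
      by (intro nth_equalityI) auto
    ultimately show "T \<in> ssyt_below 0 \<mu>"
      using assms by (auto simp: ssyt_below_def ssyt_def)
  qed
  then show ?thesis
    by (simp add: schur_poly_def)
qed


section \<open>The Jacobi-Trudi formula\<close>

text \<open>
  The entry in column \<open>j\<close> of the row with index \<open>c\<close> is the complete homogeneous polynomial
  \<open>h\<^bsub>c + j + 1 - n\<^esub>\<close> in \<open>N\<close> variables, which is zero when \<open>c + j + 1 < n\<close>.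
\<close>

primrec hom_row :: "nat \<Rightarrow> (nat \<Rightarrow> 'a :: comm_ring_1) \<Rightarrow> nat \<Rightarrow> nat \<Rightarrow> nat \<Rightarrow> 'a" where
  "hom_row n x 0 c j = of_bool (c + j + 1 = n)"
| "hom_row n x (Suc N) c j = (\<Sum>b\<le>c. x N ^ (c - b) * hom_row n x N b j)"

section \<open>Row operations and multilinear expansion\<close>

lemma hom_row_diff:
  assumes "a < c"
  shows "hom_row n x (Suc N) c j - x N ^ (c - a) * hom_row n x (Suc N) a j =
    (\<Sum>b=Suc a..c. x N ^ (c - b) * hom_row n x N b j)"
proof -
  \<comment> \<open>The factor turns the powers of row \<open>a\<close> into those of row
    \<open>c\<close>, so the terms with \<open>b \<le> a\<close> cancel.\<close>
  have "x N ^ (c - a) * hom_row n x (Suc N) a j = (\<Sum>b\<le>a. x N ^ (c - b) * hom_row n x N b j)"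
    unfolding hom_row.simps sum_distrib_left
    by (rule sum.cong) (use assms in \<open>auto simp flip: mult.assoc power_add\<close>)
  moreover have "{..c} = {..a} \<union> {Suc a..c}" "{..a} \<inter> {Suc a..c} = {}"
    using assms by auto
  ultimately show ?thesis
    by (simp add: sum.union_disjoint)
qed

text \<open>The operation is left multiplication by an upper bidiagonal matrix with unit
  diagonal.\<close>

lemma det_bidiagonal:
  fixes A :: "'a :: comm_ring_1 mat"
  assumes A: "A \<in> carrier_mat n n"
  shows "det (mat n n (\<lambda>(i, j). A $$ (i, j) - (if Suc i < n then u i * A $$ (Suc i, j) else 0))) = det A"
proof -
  define U where "U = mat n n (\<lambda>(i, k). if k = i then 1 else if k = Suc i then - u i else 0)"
  have U: "U \<in> carrier_mat n n"
    by (simp add: U_def)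
  have "det U = prod_list (diag_mat U)"
    by (rule det_upper_triangular[OF _ U]) (auto simp: U_def)
  also have "diag_mat U = replicate n 1"
    by (auto simp: diag_mat_def U_def list_eq_iff_nth_eq)
  finally have "det U = 1"
    by simp
  moreover have "mat n n (\<lambda>(i, j). A $$ (i, j) - (if Suc i < n then u i * A $$ (Suc i, j) else 0)) = U * A"
  proof (rule eq_matI)
    fix i j assume "i < dim_row (U * A)" "j < dim_col (U * A)"
    then have ij: "i < n" "j < n" using U A by auto
    have "(U * A) $$ (i, j) = (\<Sum>k\<in>{0..<n}. U $$ (i, k) * A $$ (k, j))"
      using U A ij by (auto simp: scalar_prod_def)
    also have "\<dots> = (\<Sum>k\<in>{0..<n} \<inter> {i, Suc i}. U $$ (i, k) * A $$ (k, j))"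
      by (rule sum.mono_neutral_right) (use ij in \<open>auto simp: U_def\<close>)
    also have "{0..<n} \<inter> {i, Suc i} = (if Suc i < n then {i, Suc i} else {i})"
      using ij by auto
    finally show "mat n n (\<lambda>(i, j). A $$ (i, j) - (if Suc i < n then u i * A $$ (Suc i, j) else 0)) $$ (i, j) = (U * A) $$ (i, j)"
      using ij by (simp add: U_def)
  qed (use U A in auto)
  ultimately show ?thesis
    using det_mult[OF U A] by simp
qed

text \<open>Multilinearity in the rows: in the Leibniz formula each product of sums expands over the
  choice functions \<open>f\<close>.\<close>

lemma det_sum_rows:
  fixes F :: "nat \<Rightarrow> 'b \<Rightarrow> nat \<Rightarrow> 'a :: comm_ring_1"
  assumes "\<And>i. i < n \<Longrightarrow> finite (S i)"
  shows "det (mat n n (\<lambda>(i, j). \<Sum>b\<in>S i. w i b * F i b j)) =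
    (\<Sum>f\<in>(\<Pi>\<^sub>E i\<in>{..<n}. S i). (\<Prod>i<n. w i (f i)) * det (mat n n (\<lambda>(i, j). F i (f i) j)))"
proof -
  let ?P = "{p. p permutes {0..<n}}" and ?E = "\<Pi>\<^sub>E i\<in>{..<n}. S i"
  have p: "p i < n" if "p \<in> ?P" "i < n" for p i
    using that permutes_in_image[of p "{0..<n}" i] by auto
  have "det (mat n n (\<lambda>(i, j). \<Sum>b\<in>S i. w i b * F i b j)) =
      (\<Sum>p\<in>?P. signof p * (\<Prod>i<n. \<Sum>b\<in>S i. w i b * F i b (p i)))"
    by (subst det_def'[of _ n]) (auto simp: p lessThan_atLeast0 intro!: sum.cong prod.cong arg_cong2[where f = "(*)"])
  also have "\<dots> = (\<Sum>p\<in>?P. \<Sum>f\<in>?E. (\<Prod>i<n. w i (f i)) * (signof p * (\<Prod>i<n. F i (f i) (p i))))"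
    by (subst prod_sum_PiE) (use assms in \<open>auto simp: sum_distrib_left prod.distrib mult_ac\<close>)
  also have "\<dots> = (\<Sum>f\<in>?E. (\<Prod>i<n. w i (f i)) * (\<Sum>p\<in>?P. signof p * (\<Prod>i<n. F i (f i) (p i))))"
    by (subst sum.swap) (simp add: sum_distrib_left)
  also have "\<dots> = (\<Sum>f\<in>?E. (\<Prod>i<n. w i (f i)) * det (mat n n (\<lambda>(i, j). F i (f i) j)))"
    by (intro sum.cong refl arg_cong2[where f = "(*)"], subst det_def'[of _ n])
       (auto simp: p lessThan_atLeast0 intro!: sum.cong prod.cong arg_cong2[where f = "(*)"])
  finally show ?thesis .
qed

text \<open>The Jacobi-Trudi determinant: entry \<open>(i, j)\<close> is the complete homogeneous
  polynomial of degree \<open>\<mu> ! i - i + j\<close>, read over the integers.\<close>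

definition hom_det :: "(nat \<Rightarrow> 'a :: comm_ring_1) \<Rightarrow> nat \<Rightarrow> nat list \<Rightarrow> 'a" where
  "hom_det x N \<mu> = det (mat (length \<mu>) (length \<mu>)
     (\<lambda>(i, j). hom_row (length \<mu>) x N (\<mu> ! i + (length \<mu> - 1 - i)) j))"

text \<open>
  Subtracting a multiple of the next row turns each row into a sum over one row of the
  horizontal strip; expanding the determinant gives the recursion of \<open>schur_poly_Suc\<close>.
\<close>

lemma hom_det_Suc:
  assumes "is_partition \<mu>"
  shows "hom_det x (Suc N) \<mu> = (\<Sum>f\<in>(\<Pi>\<^sub>E i\<in>{..<length \<mu>}. strip \<mu> i).
    (\<Prod>i<length \<mu>. x N ^ (\<mu> ! i - f i)) * hom_det x N (map f [0..<length \<mu>]))"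
proof -
  define n where "n = length \<mu>"
  define c where "c i = \<mu> ! i + (n - 1 - i)" for i
  let ?R = "hom_row n x"
  let ?A = "mat n n (\<lambda>(i, j). ?R (Suc N) (c i) j)"
  have desc: "\<mu> ! Suc i \<le> \<mu> ! i" if "Suc i < n" for i
    using assms that by (auto simp: is_partition_def n_def sorted_wrt_iff_nth_less)
  have "hom_det x (Suc N) \<mu> = det ?A"
    by (simp add: hom_det_def n_def c_def)
  also have "\<dots> = det (mat n n (\<lambda>(i, j). ?A $$ (i, j) -
      (if Suc i < n then x N ^ (c i - c (Suc i)) * ?A $$ (Suc i, j) else 0)))"
    by (rule det_bidiagonal[symmetric]) simp
  also have "mat n n (\<lambda>(i, j). ?A $$ (i, j) -
      (if Suc i < n then x N ^ (c i - c (Suc i)) * ?A $$ (Suc i, j) else 0)) =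
    mat n n (\<lambda>(i, j). \<Sum>b\<in>strip \<mu> i. x N ^ (\<mu> ! i - b) * ?R N (b + (n - 1 - i)) j)"
  proof (rule eq_matI, goal_cases)
    case (1 i j)
    then have ij: "i < n" "j < n" by auto
    show ?case
    proof (cases "Suc i < n")
      case True
      have "c (Suc i) < c i"
        using desc[OF True] True by (simp add: c_def)
      \<comment> \<open>The indices \<open>c\<close> carry one more unit of descent than the parts,
        so shifting by \<open>n - 1 - i\<close> identifies the range with
        \<open>strip \<mu> i\<close>.\<close>
      moreover have "Suc (c (Suc i)) = \<mu> ! Suc i + (n - 1 - i)"
        using True by (simp add: c_def)
      then have "(\<Sum>b=Suc (c (Suc i))..c i. x N ^ (c i - b) * ?R N b j) =
          (\<Sum>b\<in>strip \<mu> i. x N ^ (\<mu> ! i - b) * ?R N (b + (n - 1 - i)) j)"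
        using True unfolding c_def[of i] by (simp only: sum.shift_bounds_cl_nat_ivl strip_def flip: n_def) simp
      ultimately show ?thesis
        using ij True by (simp add: hom_row_diff del: hom_row.simps)
    next
      case False
      \<comment> \<open>The last row is not altered; its strip starts at \<open>0\<close> and gives
        the full sum defining \<open>hom_row\<close>.\<close>
      with ij have "i = n - 1" by simp
      with ij False show ?thesis
        by (simp add: strip_def c_def n_def[symmetric] atMost_atLeast0)
    qed
  qed auto
  also have "det \<dots> = (\<Sum>f\<in>(\<Pi>\<^sub>E i\<in>{..<n}. strip \<mu> i). (\<Prod>i<n. x N ^ (\<mu> ! i - f i)) *
      det (mat n n (\<lambda>(i, j). ?R N (f i + (n - 1 - i)) j)))"
    by (rule det_sum_rows) (simp add: strip_def)
  also have "\<dots> = (\<Sum>f\<in>(\<Pi>\<^sub>E i\<in>{..<n}. strip \<mu> i). (\<Prod>i<n. x N ^ (\<mu> ! i - f i)) *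
      hom_det x N (map f [0..<n]))"
  proof -
    have "mat n n (\<lambda>(i, j). ?R N (f i + (n - 1 - i)) j) =
        mat n n (\<lambda>(i, j). ?R N (map f [0..<n] ! i + (n - 1 - i)) j)" for f
      by (rule eq_matI) simp_all
    then show ?thesis
      by (simp add: hom_det_def)
  qed
  finally show ?thesis
    by (simp add: n_def)
qed

lemma hom_det_0:
  assumes "is_partition \<mu>"
  shows "hom_det x 0 \<mu> = of_bool (\<forall>i < length \<mu>. \<mu> ! i = 0)"
proof (cases "\<forall>i < length \<mu>. \<mu> ! i = 0")
  case True
  then have "mat (length \<mu>) (length \<mu>) (\<lambda>(i, j). hom_row (length \<mu>) x 0 (\<mu> ! i + (length \<mu> - 1 - i)) j) =
      1\<^sub>m (length \<mu>)"
    by (intro eq_matI) auto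
  with True show ?thesis
    by (simp add: hom_det_def)
next
  case False
  then obtain i where i: "i < length \<mu>" "\<mu> ! i > 0" by auto
  then have "\<mu> \<noteq> []" by auto
  let ?A = "mat (length \<mu>) (length \<mu>) (\<lambda>(i, j). hom_row (length \<mu>) x 0 (\<mu> ! i + (length \<mu> - 1 - i)) j)"
  \<comment> \<open>The first part is positive too, so the first row consists of polynomials of
    positive degree, which vanish in zero variables.\<close>
  have "\<mu> ! i \<le> \<mu> ! 0"
    using i assms by (cases i) (auto simp: is_partition_def sorted_wrt_iff_nth_less)
  with i have "det ?A = (\<Sum>j<length \<mu>. ?A $$ (0, j) * cofactor ?A 0 j)"
    by (intro laplace_expansion_row) auto
  also have "\<dots> = 0"
    using i \<open>\<mu> ! i \<le> \<mu> ! 0\<close> \<open>\<mu> \<noteq> []\<close> by (intro sum.neutral) auto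
  finally show ?thesis
    using False by (auto simp: hom_det_def)
qed

text \<open>Both sides have the same recursion and initial values. Zero parts are kept, so the
  matrix size stays fixed.\<close>

lemma schur_poly_eq_hom_det:
  "is_partition \<mu> \<Longrightarrow> schur_poly x N \<mu> = hom_det x N \<mu>"
proof (induction N arbitrary: \<mu>)
  case 0
  then show ?case by (simp add: schur_poly_0 hom_det_0)
next
  case (Suc N)
  then show ?case
    by (simp add: schur_poly_Suc hom_det_Suc is_partition_strip)
qed


section \<open>Near-rectangular Schur functions\<close>

lemma hom_det_eq_rows_det:
  "hom_det x N \<mu> = rows_det (map (\<lambda>i. hom_row (length \<mu>) x N (\<mu> ! i + (length \<mu> - 1 - i))) [0..<length \<mu>])"
  unfolding hom_det_def rows_det_def by (rule arg_cong[where f = det], rule eq_matI) simp_all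

section \<open>Coefficients of Schur functions from finitely many variables\<close>

abbreviation monom_var :: "nat \<Rightarrow> nat multiset \<Rightarrow>\<^sub>0 int" where
  "monom_var e \<equiv> Poly_Mapping.single {#e#} 1"

lemma prod_monom_var: "(\<Prod>e\<in>#M. monom_var e) = Poly_Mapping.single M 1"
  by (induction M) (simp_all add: mult_single)

text \<open>A tableau with content \<open>M\<close> has all entries below \<open>N\<close>, so the
  restriction loses nothing in this coefficient.\<close>

lemma lookup_schur_poly:
  assumes "set_mset M \<subseteq> {..<N}"
  shows "poly_mapping.lookup (schur_poly monom_var N \<mu>) M = Defs.coeff (schur \<mu>) M"
proof -
  have "poly_mapping.lookup (schur_poly monom_var N \<mu>) M =
      (\<Sum>T\<in>ssyt_below N \<mu>. if M = mset (concat T) then 1 else 0)"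
    by (simp add: schur_poly_def prod_monom_var Poly_Mapping.lookup_sum Poly_Mapping.lookup_single when_def)
  also have "\<dots> = int (card {T \<in> ssyt_below N \<mu>. M = mset (concat T)})"
    using finite_ssyt_below by (simp flip: sum.inter_filter)
  also have "{T \<in> ssyt_below N \<mu>. M = mset (concat T)} = {T \<in> ssyt \<mu>. mset (concat T) = M}"
    using assms unfolding ssyt_below_def by (auto simp flip: set_mset_mset simp del: set_concat)
  finally show ?thesis
    by (simp add: schur.rep_eq)
qed

text \<open>This brings the product of \<open>poly_mapping\<close> into the form of
  \<open>times_sym_fun\<close>: only submultisets \<open>A\<close> of \<open>M\<close>, paired with
  \<open>M - A\<close>, contribute.\<close>

lemma lookup_mult_multiset:
  fixes f g :: "'a multiset \<Rightarrow>\<^sub>0 'b :: comm_semiring_0"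
  shows "poly_mapping.lookup (f * g) M = (\<Sum>(A, B) | A + B = M. poly_mapping.lookup f A * poly_mapping.lookup g B)"
proof -
  have inner: "(\<Sum>B. poly_mapping.lookup g B when M = A + B) = (if A \<subseteq># M then poly_mapping.lookup g (M - A) else 0)" for A
  proof (cases "A \<subseteq># M")
    case True
    then have "(\<Sum>B. poly_mapping.lookup g B when M = A + B) = (\<Sum>B. poly_mapping.lookup g B when B = M - A)"
      by (intro arg_cong[where f = Sum_any]) (auto simp: fun_eq_iff when_def)
    with True show ?thesis by simp
  next
    case False
    then have "M \<noteq> A + B" for B
      by auto
    with False show ?thesis by simp
  qed
  have fin: "finite {A. A \<subseteq># M}"
    by (rule finite_subset[OF _ finite_imageI[OF finite_add_decomp, of fst M]])
       (auto simp: image_def mset_subset_eq_exists_conv)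
  have "poly_mapping.lookup (f * g) M = (\<Sum>A | A \<subseteq># M. poly_mapping.lookup f A * poly_mapping.lookup g (M - A))"
    unfolding lookup_mult inner using fin
    by (subst Sum_any.expand_superset[of "{A. A \<subseteq># M}"]) (auto intro!: sum.cong)
  also have "\<dots> = (\<Sum>(A, B) | A + B = M. poly_mapping.lookup f A * poly_mapping.lookup g B)"
    by (rule sum.reindex_bij_witness[where i = fst and j = "\<lambda>A. (A, M - A)"]) auto
  finally show ?thesis .
qed

lemma coeff_schur_mult:
  assumes "set_mset M \<subseteq> {..<N}"
  shows "Defs.coeff (schur \<mu> * schur \<nu>) M = poly_mapping.lookup (schur_poly monom_var N \<mu> * schur_poly monom_var N \<nu>) M"
  unfolding times_sym_fun.rep_eq lookup_mult_multiset
  using assms by (intro sum.cong) (auto simp: lookup_schur_poly)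

text \<open>
  With \<open>c = p + r + 1 - l\<close> and \<open>d = p + r + 1\<close>, the row indices of the six determinants are
  \<open>d, A, B, k\<close> and \<open>A, c, B, 0\<close>; \<open>A, B, k, 0\<close> and \<open>d, A, c, B\<close>; \<open>A, c, B, k\<close> and \<open>d, A, B, 0\<close>.
\<close>

lemma length_near_rect [simp]: "l \<le> r \<Longrightarrow> length (near_rect r p l k) = r + 1"
  by (simp add: near_rect_def)

lemma nth_near_rect:
  "l \<le> r \<Longrightarrow> i < r + 1 \<Longrightarrow> near_rect r p l k ! i = (if i < l then p + 1 else if i < r then p else k)"
  by (auto simp: near_rect_def nth_append not_less less_Suc_eq)

lemma schur_poly_near_rect:
  fixes r p l k :: nat
  assumes "1 \<le> l" "l \<le> r" "1 \<le> k" "k \<le> p"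
  shows "schur_poly x N (near_rect r p l k) * schur_poly x N (near_rect r p 0 0) =
    schur_poly x N (near_rect (r - 1) (p - 1) (l - 1) (k - 1) @ [0]) * schur_poly x N (replicate (r + 1) (p + 1)) +
    schur_poly x N (near_rect r p 0 k) * schur_poly x N (near_rect r p l 0)"
proof -
  define H where "H = hom_row (r + 1) x N"
  \<comment> \<open>The first \<open>r\<close> row indices of \<open>near_rect r p 0 0\<close> are
    \<open>p + r - i\<close>; \<open>A\<close> and \<open>B\<close> are the stretches before and
    after \<open>?c\<close>, at position \<open>l - 1\<close>. Raising the first \<open>l\<close>
    parts by one trades \<open>?c\<close> for \<open>?d\<close>.\<close>
  define A where "A = map (\<lambda>i. H (p + r - i)) [0..<l - 1]"
  define B where "B = map (\<lambda>i. H (p + r - l - i)) [0..<r - l]"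
  let ?c = "H (p + r + 1 - l)" and ?d = "H (p + r + 1)"
  have eq: "schur_poly x N \<mu> = rows_det V"
    if "is_partition \<mu>" "length \<mu> = r + 1" "length V = r + 1"
      "\<And>i. i < r + 1 \<Longrightarrow> V ! i = H (\<mu> ! i + (r - i))" for \<mu> V
    unfolding schur_poly_eq_hom_det[OF that(1)] hom_det_eq_rows_det
    by (rule arg_cong[where f = rows_det], rule nth_equalityI) (use that in \<open>simp_all add: H_def del: upt_Suc\<close>)
  have len: "length A = l - 1" "length B = r - l"
    by (simp_all add: A_def B_def)
  have nth: "i < l - 1 \<Longrightarrow> A ! i = H (p + r - i)" "i < r - l \<Longrightarrow> B ! i = H (p + r - l - i)" for i
    by (simp_all add: A_def B_def)
  have part: "is_partition (near_rect (r - 1) (p - 1) (l - 1) (k - 1) @ [0])"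
    "is_partition (replicate (r + 1) (p + 1))"
    using assms is_partition_near_rect[of "k - 1" "p - 1" "r - 1" "l - 1"]
    by (auto simp: is_partition_def sorted_wrt_append sorted_wrt_ge_replicate simp del: replicate_Suc)
  have "schur_poly x N (near_rect r p l k) = rows_det (?d # A @ B @ [H k])"
    by (rule eq) (use assms in \<open>auto simp: nth_near_rect len nth nth_append nth_Cons is_partition_near_rect
        split: nat.splits intro!: arg_cong[where f = H]\<close>)
  moreover have "schur_poly x N (near_rect r p 0 0) = rows_det (A @ ?c # B @ [H 0])"
    by (rule eq) (use assms in \<open>auto simp: nth_near_rect len nth nth_append nth_Cons is_partition_near_rect
        split: nat.splits intro!: arg_cong[where f = H]\<close>)
  \<comment> \<open>The appended zero raises the other row indices by one, which makes up for
    \<open>p - 1\<close> and \<open>k - 1\<close>.\<close>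
  moreover have "schur_poly x N (near_rect (r - 1) (p - 1) (l - 1) (k - 1) @ [0]) = rows_det (A @ B @ [H k, H 0])"
    by (rule eq) (use assms part in \<open>auto simp: nth_near_rect len nth nth_append nth_Cons
        split: nat.splits intro!: arg_cong[where f = H]\<close>)
  moreover have "schur_poly x N (replicate (r + 1) (p + 1)) = rows_det (?d # A @ ?c # B)"
    by (rule eq) (use assms part in \<open>auto simp: len nth nth_append nth_Cons simp del: replicate_Suc
        split: nat.splits intro!: arg_cong[where f = H]\<close>)
  moreover have "schur_poly x N (near_rect r p 0 k) = rows_det (A @ ?c # B @ [H k])"
    by (rule eq) (use assms in \<open>auto simp: nth_near_rect len nth nth_append nth_Cons is_partition_near_rect
        split: nat.splits intro!: arg_cong[where f = H]\<close>)
  moreover have "schur_poly x N (near_rect r p l 0) = rows_det (?d # A @ B @ [H 0])"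
    by (rule eq) (use assms in \<open>auto simp: nth_near_rect len nth nth_append nth_Cons is_partition_near_rect
        split: nat.splits intro!: arg_cong[where f = H]\<close>)
  ultimately show ?thesis
    using rows_det_three_term[of ?d A B "H k" ?c "H 0"] by simp
qed

theorem proposition3:
  fixes r p l k :: nat
  assumes "1 \<le> l" "l \<le> r" "1 \<le> k" "k \<le> p"
  shows "schur (near_rect r p l k) * schur (near_rect r p 0 0) =
    schur (near_rect (r - 1) (p - 1) (l - 1) (k - 1)) * schur (near_rect (r + 1) (p + 1) 0 0) +
    schur (near_rect r p 0 k) * schur (near_rect r p l 0)"
proof -
  \<comment> \<open>All shapes are brought to \<open>r + 1\<close> parts: the smaller one gains a
    zero, the larger rectangle loses one.\<close>
  have "schur (near_rect (r - 1) (p - 1) (l - 1) (k - 1)) =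
      schur (near_rect (r - 1) (p - 1) (l - 1) (k - 1) @ [0])"
    using assms by (simp add: schur_append_zero is_partition_near_rect)
  moreover have "schur (near_rect (r + 1) (p + 1) 0 0) = schur (replicate (r + 1) (p + 1))"
    using schur_append_zero[of "replicate (r + 1) (p + 1)"]
    by (simp add: near_rect_def is_partition_def sorted_wrt_ge_replicate del: replicate_Suc)
  moreover have "schur (near_rect r p l k) * schur (near_rect r p 0 0) =
    schur (near_rect (r - 1) (p - 1) (l - 1) (k - 1) @ [0]) * schur (replicate (r + 1) (p + 1)) +
      schur (near_rect r p 0 k) * schur (near_rect r p l 0)"
  proof (rule Defs.coeff_inject[THEN iffD1], rule ext)
    fix M
    \<comment> \<open>The number of variables is chosen for each coefficient separately; for empty
      \<open>M\<close> the inclusion is trivial.\<close>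
    have "set_mset M \<subseteq> {..<Suc (Max (set_mset M))}"
      by (auto simp: less_Suc_eq_le)
    then show "Defs.coeff (schur (near_rect r p l k) * schur (near_rect r p 0 0)) M =
        Defs.coeff (schur (near_rect (r - 1) (p - 1) (l - 1) (k - 1) @ [0]) * schur (replicate (r + 1) (p + 1)) +
          schur (near_rect r p 0 k) * schur (near_rect r p l 0)) M"
      by (simp only: plus_sym_fun.rep_eq coeff_schur_mult schur_poly_near_rect[OF assms] lookup_add)
  qed
  ultimately show ?thesis
    by (simp only:)
qed

end
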